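(* Let $M$ be an oriented surface in $\mathbb{E}^3$ and let $\gamma: I\subset\mathbb{R}\to M$ be a unit speed curve on $M$ with $\tau_g(s)\neq 0$ for all $s\in I$. Suppose $\gamma$ is a relatively normal-slant helix with axis the fixed unit vector $d$ and constant angle $\theta\in[0,\pi]$, i.e. $\langle\mathsf{V}(s),d\rangle=\cos\theta$ for all $s$. Then there is a sign $\varepsilon\in\{1,-1\}$, independent of $s$, such that for all $s\in I$ $$d=\varepsilon\frac{\tau_g}{\sqrt{\kappa_g^2+\tau_g^2}}\sin\theta\,\mathsf{T}+\cos\theta\,\mathsf{V}+\varepsilon\frac{\kappa_g}{\sqrt{\kappa_g^2+\tau_g^2}}\sin\theta\,\mathsf{U}$$ and $$\cot\theta=\varepsilon\,\frac{\tau_g'\kappa_g-\kappa_g'\tau_g-\kappa_n(\kappa_g^2+\tau_g^2)}{(\kappa_g^2+\tau_g^2)^{3/2}}.$$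
   Context: $\mathbb{E}^3$ is Euclidean 3-space, $I$ is an interval; surfaces and curves are smooth. For a unit speed curve $\gamma$ on an oriented surface $M\subset\mathbb{E}^3$, the Darboux frame along $\gamma$ is $\{\mathsf{T},\mathsf{V},\mathsf{U}\}$, where $\mathsf{T}=\gamma'$ is the unit tangent vector field, $\mathsf{U}$ is the unit normal vector field of $M$ restricted to $\gamma$, and $\mathsf{V}=\mathsf{U}\times\mathsf{T}$. The geodesic curvature $\kappa_g$, normal curvature $\kappa_n$ and geodesic torsion $\tau_g$ are defined by $$\mathsf{T}'=\kappa_g\mathsf{V}+\kappa_n\mathsf{U},\quad \mathsf{V}'=-\kappa_g\mathsf{T}+\tau_g\mathsf{U},\quad \mathsf{U}'=-\kappa_n\mathsf{T}-\tau_g\mathsf{V}.$$ The curve $\gamma$ is called a relatively normal-slant helix if there exist a fixed unit vector $d$ (the axis) and a constant angle $\theta$ such that $\langle\mathsf{V}(s),d\rangle=\cos\theta$ for all $s$. *)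

theory Defs
  imports "HOL-Analysis.Analysis"
begin

section \<open>Smoothness\<close>

text \<open>
  For an open set S, this is the usual notion of a map of class C^k: all iterated directional
  derivatives up to order k exist as Frechet derivatives and are continuous.
\<close>
fun C_k_on :: "nat \<Rightarrow> ('a::euclidean_space \<Rightarrow> 'b::euclidean_space) \<Rightarrow> 'a set \<Rightarrow> bool" where
  "C_k_on 0 f S \<longleftrightarrow> continuous_on S f"
| "C_k_on (Suc k) f S \<longleftrightarrow>
     (\<forall>x\<in>S. f differentiable (at x)) \<and>
     (\<forall>v. C_k_on k (\<lambda>x. frechet_derivative f (at x) v) S)"

definition smooth_on_open :: "('a::euclidean_space \<Rightarrow> 'b::euclidean_space) \<Rightarrow> 'a set \<Rightarrow> bool" where
  "smooth_on_open f S \<longleftrightarrow> open S \<and> (\<forall>k. C_k_on k f S)"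

text \<open>Smoothness on an arbitrary subset of Euclidean space: local extendability to smooth maps.\<close>
definition smooth_on_subset :: "('a::euclidean_space \<Rightarrow> 'b::euclidean_space) \<Rightarrow> 'a set \<Rightarrow> bool" where
  "smooth_on_subset f M \<longleftrightarrow>
     (\<forall>p\<in>M. \<exists>W g. p \<in> W \<and> smooth_on_open g W \<and> (\<forall>x\<in>M \<inter> W. g x = f x))"

text \<open>
  The derivative of a function of one real variable on a nondegenerate interval I, one-sided
  at those endpoints that belong to I.
\<close>
definition deriv_on :: "real set \<Rightarrow> (real \<Rightarrow> 'a::real_normed_vector) \<Rightarrow> real \<Rightarrow> 'a" where
  "deriv_on I f = (\<lambda>s. vector_derivative f (at s within I))"

definition smooth_curve_on :: "real set \<Rightarrow> (real \<Rightarrow> 'a::real_normed_vector) \<Rightarrow> bool" where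
  "smooth_curve_on I f \<longleftrightarrow> (\<forall>k. ((deriv_on I ^^ k) f) differentiable_on I)"


section \<open>Oriented surfaces in Euclidean 3-space\<close>

definition regular_surface :: "(real^3) set \<Rightarrow> bool" where
  "regular_surface M \<longleftrightarrow>
     (\<forall>p\<in>M. \<exists>W Q (X :: real^2 \<Rightarrow> real^3) Y.
        open W \<and> p \<in> W \<and> smooth_on_open X Q \<and> homeomorphism Q (M \<inter> W) X Y \<and>
        (\<forall>q\<in>Q. inj (frechet_derivative X (at q))))"

text \<open>The tangent plane consists of the velocities at time 0 of smooth curves in M through p.\<close>
definition tangent_space :: "(real^3) set \<Rightarrow> real^3 \<Rightarrow> (real^3) set" where
  "tangent_space M p =
     {v. \<exists>e>0. \<exists>\<alpha>. smooth_curve_on {-e<..<e} \<alpha> \<and> \<alpha> ` {-e<..<e} \<subseteq> M \<and> \<alpha> 0 = p \<and>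
           deriv_on {-e<..<e} \<alpha> 0 = v}"

text \<open>The orientation of M is given by the smooth unit normal field N.\<close>
definition oriented_surface :: "(real^3) set \<Rightarrow> (real^3 \<Rightarrow> real^3) \<Rightarrow> bool" where
  "oriented_surface M N \<longleftrightarrow>
     regular_surface M \<and> smooth_on_subset N M \<and>
     (\<forall>p\<in>M. norm (N p) = 1 \<and> (\<forall>v\<in>tangent_space M p. N p \<bullet> v = 0))"


section \<open>Curves on surfaces and the Darboux frame\<close>

text \<open>
  The interval I may be open, closed, half-open, bounded or unbounded; a nonempty interior rules
  out single points, where derivatives make no sense.
\<close>
definition unit_speed_curve_on_surface ::
    "(real^3) set \<Rightarrow> real set \<Rightarrow> (real \<Rightarrow> real^3) \<Rightarrow> bool" where
  "unit_speed_curve_on_surface M I \<gamma> \<longleftrightarrow>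
     is_interval I \<and> interior I \<noteq> {} \<and> smooth_curve_on I \<gamma> \<and> \<gamma> ` I \<subseteq> M \<and>
     (\<forall>s\<in>I. norm (deriv_on I \<gamma> s) = 1)"

definition darboux_T :: "real set \<Rightarrow> (real \<Rightarrow> real^3) \<Rightarrow> real \<Rightarrow> real^3" where
  "darboux_T I \<gamma> = deriv_on I \<gamma>"

definition darboux_U :: "(real^3 \<Rightarrow> real^3) \<Rightarrow> (real \<Rightarrow> real^3) \<Rightarrow> real \<Rightarrow> real^3" where
  "darboux_U N \<gamma> = (\<lambda>s. N (\<gamma> s))"

definition darboux_V ::
    "(real^3 \<Rightarrow> real^3) \<Rightarrow> real set \<Rightarrow> (real \<Rightarrow> real^3) \<Rightarrow> real \<Rightarrow> real^3" where
  "darboux_V N I \<gamma> = (\<lambda>s. cross3 (darboux_U N \<gamma> s) (darboux_T I \<gamma> s))"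

text \<open>
  The three curvatures are the coefficients in the Darboux equations; since the frame is
  orthonormal, they are read off by inner products. Lemma \<open>darboux_equations\<close> below verifies that
  the functions so defined satisfy the equations, and \<open>darboux_equations_unique\<close> that no others do.
\<close>
definition geodesic_curvature ::
    "(real^3 \<Rightarrow> real^3) \<Rightarrow> real set \<Rightarrow> (real \<Rightarrow> real^3) \<Rightarrow> real \<Rightarrow> real" where
  "geodesic_curvature N I \<gamma> = (\<lambda>s. deriv_on I (darboux_T I \<gamma>) s \<bullet> darboux_V N I \<gamma> s)"

definition normal_curvature ::
    "(real^3 \<Rightarrow> real^3) \<Rightarrow> real set \<Rightarrow> (real \<Rightarrow> real^3) \<Rightarrow> real \<Rightarrow> real" where
  "normal_curvature N I \<gamma> = (\<lambda>s. deriv_on I (darboux_T I \<gamma>) s \<bullet> darboux_U N \<gamma> s)"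

definition geodesic_torsion ::
    "(real^3 \<Rightarrow> real^3) \<Rightarrow> real set \<Rightarrow> (real \<Rightarrow> real^3) \<Rightarrow> real \<Rightarrow> real" where
  "geodesic_torsion N I \<gamma> = (\<lambda>s. deriv_on I (darboux_V N I \<gamma>) s \<bullet> darboux_U N \<gamma> s)"

definition relatively_normal_slant_helix ::
    "(real^3 \<Rightarrow> real^3) \<Rightarrow> real set \<Rightarrow> (real \<Rightarrow> real^3) \<Rightarrow> real^3 \<Rightarrow> real \<Rightarrow> bool" where
  "relatively_normal_slant_helix N I \<gamma> d \<theta> \<longleftrightarrow>
     norm d = 1 \<and> (\<forall>s\<in>I. darboux_V N I \<gamma> s \<bullet> d = cos \<theta>)"


section \<open>The Darboux equations\<close>

lemma interval_limits:
  fixes I :: "real set"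
  assumes "is_interval I" "interior I \<noteq> {}" "s \<in> I"
  shows "at s within I \<noteq> bot" "at s within interior I \<noteq> bot"
proof -
  have "convex I" using assms is_interval_convex by blast
  hence "closure (interior I) = closure I" using assms convex_closure_interior by blast
  hence "s \<in> closure (interior I)" using assms closure_subset by blast
  hence "s islimpt interior I"
    using interior_limit_point[of s "interior I"] by (auto simp: closure_def)
  thus "at s within interior I \<noteq> bot" by (simp add: trivial_limit_within)
  thus "at s within I \<noteq> bot"
    using at_le[OF interior_subset[of I], of s] bot.extremum_uniqueI by force
qed

lemma deriv_on_eq:
  assumes "is_interval I" "interior I \<noteq> {}" "s \<in> I" "(f has_vector_derivative f') (at s within I)"
  shows "deriv_on I f s = f'"
  unfolding deriv_on_def using assms interval_limits(1) vector_derivative_within by blast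

lemma deriv_on_works:
  assumes "f differentiable (at s within I)"
  shows "(f has_vector_derivative deriv_on I f s) (at s within I)"
  using assms unfolding deriv_on_def by (simp add: vector_derivative_works)

lemma deriv_on_shift:
  fixes f g :: "real \<Rightarrow> 'a::real_normed_vector"
  assumes "e > 0" "{s-e<..<s+e} \<subseteq> I"
    and eq: "\<And>u. u \<in> {-e<..<e} \<Longrightarrow> g u = f (s + u)"
    and diff: "f differentiable_on I" and t: "t \<in> {-e<..<e}"
  shows "(g has_vector_derivative deriv_on I f (s + t)) (at t within {-e<..<e})"
proof -
  have st: "s + t \<in> {s-e<..<s+e}" using t by auto
  hence "f differentiable (at (s + t) within I)"
    using diff assms(2) unfolding differentiable_on_def by blast
  hence "(f has_vector_derivative deriv_on I f (s + t)) (at (s + t) within I)"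
    by (rule deriv_on_works)
  hence "(f has_vector_derivative deriv_on I f (s + t)) (at (s + t) within {s-e<..<s+e})"
    using assms(2) has_vector_derivative_within_subset by blast
  hence F: "(f has_vector_derivative deriv_on I f (s + t)) (at (s + t))"
    using at_within_open[OF st open_greaterThanLessThan] by simp
  have "((\<lambda>u. s + u) has_vector_derivative 1) (at t)"
    by (auto intro!: derivative_eq_intros)
  from vector_diff_chain_at[OF this F]
  have "((\<lambda>u. f (s + u)) has_vector_derivative deriv_on I f (s + t)) (at t)"
    by (simp add: o_def)
  hence "(g has_vector_derivative deriv_on I f (s + t)) (at t)"
    using has_vector_derivative_transform_within_open[of _ _ t "{-e<..<e}" g] eq t by force
  thus ?thesis using has_vector_derivative_at_within by blast
qed

lemma smooth_curve_shift:
  fixes f :: "real \<Rightarrow> 'a::real_normed_vector"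
  assumes "e > 0" "{s-e<..<s+e} \<subseteq> I" "smooth_curve_on I f"
  shows "smooth_curve_on {-e<..<e} (\<lambda>u. f (s + u))"
    and "deriv_on {-e<..<e} (\<lambda>u. f (s + u)) 0 = deriv_on I f s"
proof -
  let ?J = "{-e<..<e}"
  let ?g = "\<lambda>u. f (s + u)"
  have int: "is_interval ?J" "interior ?J \<noteq> {}"
    using \<open>e > 0\<close> by (auto simp: is_interval_oo interior_open)
  have D: "((deriv_on I ^^ k) f) differentiable_on I" for k
    using assms(3) by (simp add: smooth_curve_on_def)
  have E: "\<forall>t\<in>?J. (deriv_on ?J ^^ k) ?g t = (deriv_on I ^^ k) f (s + t)" for k
  proof (induction k)
    case (Suc k)
    show ?case
    proof
      fix t assume t: "t \<in> ?J"
      have "((deriv_on ?J ^^ k) ?g has_vector_derivative deriv_on I ((deriv_on I ^^ k) f) (s + t))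
              (at t within ?J)"
        by (rule deriv_on_shift[OF assms(1,2) _ D t]) (use Suc in blast)
      from deriv_on_eq[OF int t this]
      show "(deriv_on ?J ^^ Suc k) ?g t = (deriv_on I ^^ Suc k) f (s + t)" by simp
    qed
  qed simp
  show "smooth_curve_on ?J ?g"
    unfolding smooth_curve_on_def differentiable_on_def
  proof (intro allI ballI)
    fix k t assume t: "t \<in> ?J"
    have "((deriv_on ?J ^^ k) ?g has_vector_derivative deriv_on I ((deriv_on I ^^ k) f) (s + t))
            (at t within ?J)"
      by (rule deriv_on_shift[OF assms(1,2) _ D t]) (use E in blast)
    thus "((deriv_on ?J ^^ k) ?g) differentiable (at t within ?J)"
      by (auto simp: differentiable_def has_vector_derivative_def)
  qed
  show "deriv_on ?J ?g 0 = deriv_on I f s"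
    using E[of 1] \<open>e > 0\<close> by simp
qed

lemma orthonormal_frame_expand:
  fixes T U w :: "real^3"
  assumes "norm T = 1" "norm U = 1" "U \<bullet> T = 0"
  defines "V \<equiv> cross3 U T"
  shows "norm V = 1" "V \<bullet> T = 0" "V \<bullet> U = 0"
    and "w = (w \<bullet> T) *\<^sub>R T + (w \<bullet> V) *\<^sub>R V + (w \<bullet> U) *\<^sub>R U"
proof -
  have "(norm V)\<^sup>2 = 1" using norm_cross_dot[of U T] assms by simp
  thus V1: "norm V = 1" using norm_ge_zero[of V] by (auto simp: power2_eq_1_iff)
  show VT: "V \<bullet> T = 0" and VU: "V \<bullet> U = 0"
    unfolding V_def by (simp_all add: dot_cross_self)
  define r where "r = w - ((w \<bullet> T) *\<^sub>R T + (w \<bullet> V) *\<^sub>R V + (w \<bullet> U) *\<^sub>R U)"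
  have n: "T \<bullet> T = 1" "U \<bullet> U = 1" "V \<bullet> V = 1"
    using assms V1 by (simp_all add: dot_square_norm)
  have TU: "T \<bullet> U = 0" "T \<bullet> V = 0" "U \<bullet> V = 0"
    using assms VT VU by (simp_all add: inner_commute)
  have rT: "r \<bullet> T = 0" and rV: "r \<bullet> V = 0" and rU: "r \<bullet> U = 0"
    unfolding r_def using n TU VT VU assms(3)
    by (simp_all add: inner_diff_left inner_add_left)
  have "cross3 r (cross3 U T) = (r \<bullet> T) *\<^sub>R U - (r \<bullet> U) *\<^sub>R T"
    by (simp add: cross3_simps forall_3)
  hence "cross3 r V = 0" using rT rU by (simp add: V_def)
  hence "(norm r * norm V)\<^sup>2 = 0" using norm_cross_dot[of r V] rV by simp
  hence "r = 0" using V1 by simp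
  thus "w = (w \<bullet> T) *\<^sub>R T + (w \<bullet> V) *\<^sub>R V + (w \<bullet> U) *\<^sub>R U" by (simp add: r_def)
qed

lemma deriv_on_inner_const:
  fixes f g :: "real \<Rightarrow> 'a::real_inner"
  assumes I: "is_interval I" "interior I \<noteq> {}" "s \<in> I"
    and f: "f differentiable (at s within I)" and g: "g differentiable (at s within I)"
    and c: "\<And>t. t \<in> I \<Longrightarrow> f t \<bullet> g t = c"
  shows "deriv_on I f s \<bullet> g s = - (deriv_on I g s \<bullet> f s)"
proof -
  have "((\<lambda>t. f t \<bullet> g t) has_vector_derivative
          (f s \<bullet> deriv_on I g s + deriv_on I f s \<bullet> g s)) (at s within I)"
    using bounded_bilinear.has_vector_derivative[OF bounded_bilinear_inner
        deriv_on_works[OF f] deriv_on_works[OF g]] .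
  moreover have "((\<lambda>t. f t \<bullet> g t) has_vector_derivative 0) (at s within I)"
    by (rule has_vector_derivative_transform[OF I(3) c has_vector_derivative_const]) simp_all
  ultimately have "f s \<bullet> deriv_on I g s + deriv_on I f s \<bullet> g s = 0"
    using deriv_on_eq[OF I] by metis
  thus ?thesis by (simp add: inner_commute)
qed

lemma darboux_differentiable:
  assumes M: "oriented_surface M N" and \<gamma>: "unit_speed_curve_on_surface M I \<gamma>" and s: "s \<in> I"
  shows "darboux_T I \<gamma> differentiable (at s within I)"
    and "darboux_U N \<gamma> differentiable (at s within I)"
    and "darboux_V N I \<gamma> differentiable (at s within I)"
proof -
  have D: "((deriv_on I ^^ k) \<gamma>) differentiable (at s within I)" for k
    using \<gamma> s by (auto simp: unit_speed_curve_on_surface_def smooth_curve_on_def differentiable_on_def)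
  show T: "darboux_T I \<gamma> differentiable (at s within I)"
    using D[of 1] by (simp add: darboux_T_def)
  have g: "\<gamma> differentiable (at s within I)" using D[of 0] by simp
  have im: "\<gamma> t \<in> M" if "t \<in> I" for t
    using \<gamma> that by (auto simp: unit_speed_curve_on_surface_def)
  obtain W G where W: "\<gamma> s \<in> W" "smooth_on_open G W" "\<And>x. x \<in> M \<inter> W \<Longrightarrow> G x = N x"
    using M im[OF s] unfolding oriented_surface_def smooth_on_subset_def by metis
  have "C_k_on (Suc 0) G W" "open W" using W(2) unfolding smooth_on_open_def by blast+
  hence G: "G differentiable (at (\<gamma> s))" using W(1) by simp
  have "(\<lambda>t. G (\<gamma> t)) differentiable (at s within I)"
    using differentiable_chain_within[OF g, of G] G differentiable_at_withinI
    by (auto simp: o_def)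
  then obtain F where F: "((\<lambda>t. G (\<gamma> t)) has_derivative F) (at s within I)"
    unfolding differentiable_def by blast
  have "continuous (at s within I) \<gamma>" using g differentiable_imp_continuous_within by blast
  hence "\<forall>\<^sub>F t in at s within I. \<gamma> t \<in> W"
    using W(1) \<open>open W\<close> by (simp add: continuous_within topological_tendstoD)
  then obtain \<delta> where \<delta>: "\<delta> > 0" "\<And>t. t \<in> I \<Longrightarrow> dist t s < \<delta> \<Longrightarrow> \<gamma> t \<in> W"
    using W(1) unfolding eventually_at by metis
  have "(darboux_U N \<gamma> has_derivative F) (at s within I)"
    by (rule has_derivative_transform_within[OF F \<delta>(1) s])
       (use \<delta> W im in \<open>auto simp: darboux_U_def\<close>)
  thus U: "darboux_U N \<gamma> differentiable (at s within I)"
    unfolding differentiable_def by blast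
  have "bounded_bilinear cross3"
    using bilinear_cross bilinear_conv_bounded_bilinear by blast
  from bounded_bilinear.FDERIV[OF this] U T
  show "darboux_V N I \<gamma> differentiable (at s within I)"
    unfolding differentiable_def darboux_V_def by blast
qed

lemma darboux_orthonormal:
  assumes M: "oriented_surface M N" and \<gamma>: "unit_speed_curve_on_surface M I \<gamma>" and s: "s \<in> I"
  shows "norm (darboux_T I \<gamma> s) = 1" "norm (darboux_U N \<gamma> s) = 1"
    and "darboux_U N \<gamma> s \<bullet> darboux_T I \<gamma> s = 0"
proof -
  have im: "\<gamma> t \<in> M" if "t \<in> I" for t
    using \<gamma> that by (auto simp: unit_speed_curve_on_surface_def)
  have I: "is_interval I" "interior I \<noteq> {}" and sm: "smooth_curve_on I \<gamma>"
    using \<gamma> by (auto simp: unit_speed_curve_on_surface_def)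
  show "norm (darboux_T I \<gamma> s) = 1" "norm (darboux_U N \<gamma> s) = 1"
    using M \<gamma> s im[OF s]
    by (auto simp: unit_speed_curve_on_surface_def oriented_surface_def darboux_T_def darboux_U_def)
  let ?f = "\<lambda>t. darboux_U N \<gamma> t \<bullet> darboux_T I \<gamma> t"
  have z: "?f t = 0" if t: "t \<in> interior I" for t
  proof -
    obtain e where e: "e > 0" "ball t e \<subseteq> I"
      using mem_interior[THEN iffD1, OF t] by blast
    hence e2: "{t-e<..<t+e} \<subseteq> I"
      by (metis ball_eq_greaterThanLessThan)
    have "deriv_on I \<gamma> t \<in> tangent_space M (\<gamma> t)"
      unfolding tangent_space_def
    proof (intro CollectI exI[of _ e] exI[of _ "\<lambda>u. \<gamma> (t + u)"] conjI)
      show "(\<lambda>u. \<gamma> (t + u)) ` {-e<..<e} \<subseteq> M"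
      proof (intro image_subsetI im)
        fix u assume "u \<in> {-e<..<e}"
        hence "t + u \<in> {t-e<..<t+e}" by auto
        thus "t + u \<in> I" using e2 by blast
      qed
    qed (use e smooth_curve_shift[OF e(1) e2 sm] in auto)
    thus ?thesis using M im interior_subset[of I] t
      unfolding oriented_surface_def darboux_U_def darboux_T_def by blast
  qed
  have "continuous (at s within I) ?f"
    using darboux_differentiable[OF M \<gamma> s] differentiable_imp_continuous_within
    by (intro continuous_inner) blast+
  hence "(?f \<longlongrightarrow> ?f s) (at s within interior I)"
    by (meson continuous_within interior_subset tendsto_within_subset)
  moreover have "(?f \<longlongrightarrow> 0) (at s within interior I)"
    by (rule tendsto_eventually) (auto simp: eventually_at_filter z)
  ultimately show "?f s = 0"
    using tendsto_unique[OF interval_limits(2)[OF I s]] by blast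
qed

lemma darboux_equations:
  assumes M: "oriented_surface M N" and \<gamma>: "unit_speed_curve_on_surface M I \<gamma>" and s: "s \<in> I"
  shows "(darboux_T I \<gamma> has_vector_derivative
            geodesic_curvature N I \<gamma> s *\<^sub>R darboux_V N I \<gamma> s +
            normal_curvature N I \<gamma> s *\<^sub>R darboux_U N \<gamma> s) (at s within I)" (is ?T)
    and "(darboux_V N I \<gamma> has_vector_derivative
            - geodesic_curvature N I \<gamma> s *\<^sub>R darboux_T I \<gamma> s +
            geodesic_torsion N I \<gamma> s *\<^sub>R darboux_U N \<gamma> s) (at s within I)" (is ?V)
    and "(darboux_U N \<gamma> has_vector_derivative
            - normal_curvature N I \<gamma> s *\<^sub>R darboux_T I \<gamma> s -
            geodesic_torsion N I \<gamma> s *\<^sub>R darboux_V N I \<gamma> s) (at s within I)" (is ?U)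
proof -
  have I: "is_interval I" "interior I \<noteq> {}"
    using \<gamma> by (auto simp: unit_speed_curve_on_surface_def)
  define T where "T = darboux_T I \<gamma>"
  define U where "U = darboux_U N \<gamma>"
  define V where "V = darboux_V N I \<gamma>"
  note defs = T_def[symmetric] U_def[symmetric] V_def[symmetric]
  have Vc: "V t = cross3 (U t) (T t)" for t by (simp add: T_def U_def V_def darboux_V_def)
  note dT = darboux_differentiable(1)[OF M \<gamma> s, unfolded defs]
  note dU = darboux_differentiable(2)[OF M \<gamma> s, unfolded defs]
  note dV = darboux_differentiable(3)[OF M \<gamma> s, unfolded defs]
  note on = darboux_orthonormal[OF M \<gamma>, unfolded defs]
  note fr = orthonormal_frame_expand[OF on, folded Vc]
  have oT: "\<And>t. t \<in> I \<Longrightarrow> T t \<bullet> T t = 1" and oU: "\<And>t. t \<in> I \<Longrightarrow> U t \<bullet> U t = 1"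
    and oV: "\<And>t. t \<in> I \<Longrightarrow> V t \<bullet> V t = 1"
    using on fr(1) by (simp_all add: dot_square_norm)
  note C = deriv_on_inner_const[OF I s]
  have 1: "deriv_on I T s \<bullet> T s = 0" "deriv_on I U s \<bullet> U s = 0" "deriv_on I V s \<bullet> V s = 0"
    using C[OF dT dT oT] C[OF dU dU oU] C[OF dV dV oV] by simp_all
  have 2: "deriv_on I V s \<bullet> T s = - (deriv_on I T s \<bullet> V s)"
    "deriv_on I U s \<bullet> T s = - (deriv_on I T s \<bullet> U s)"
    "deriv_on I U s \<bullet> V s = - (deriv_on I V s \<bullet> U s)"
    using C[OF dV dT fr(2)] C[OF dU dT on(3)] C[OF dV dU fr(3)] by simp_all
  have "deriv_on I T s = geodesic_curvature N I \<gamma> s *\<^sub>R V s + normal_curvature N I \<gamma> s *\<^sub>R U s"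
    using fr(4)[OF s s s, of "deriv_on I T s"] 1
    by (simp add: geodesic_curvature_def normal_curvature_def defs)
  thus ?T using deriv_on_works[OF dT] by (simp add: defs)
  have "deriv_on I V s = - geodesic_curvature N I \<gamma> s *\<^sub>R T s + geodesic_torsion N I \<gamma> s *\<^sub>R U s"
    using fr(4)[OF s s s, of "deriv_on I V s"] 1 2
    by (simp add: geodesic_curvature_def geodesic_torsion_def defs)
  thus ?V using deriv_on_works[OF dV] by (simp add: defs)
  have "deriv_on I U s = - normal_curvature N I \<gamma> s *\<^sub>R T s - geodesic_torsion N I \<gamma> s *\<^sub>R V s"
    using fr(4)[OF s s s, of "deriv_on I U s"] 1 2
    by (simp add: normal_curvature_def geodesic_torsion_def defs)
  thus ?U using deriv_on_works[OF dU] by (simp add: defs)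
qed

lemma darboux_equations_unique:
  assumes M: "oriented_surface M N" and \<gamma>: "unit_speed_curve_on_surface M I \<gamma>" and s: "s \<in> I"
    and T: "deriv_on I (darboux_T I \<gamma>) s = kg *\<^sub>R darboux_V N I \<gamma> s + kn *\<^sub>R darboux_U N \<gamma> s"
    and V: "deriv_on I (darboux_V N I \<gamma>) s = - kg *\<^sub>R darboux_T I \<gamma> s + tg *\<^sub>R darboux_U N \<gamma> s"
  shows "kg = geodesic_curvature N I \<gamma> s" "kn = normal_curvature N I \<gamma> s"
    and "tg = geodesic_torsion N I \<gamma> s"
proof -
  note on = darboux_orthonormal[OF M \<gamma> s]
  have Vc: "cross3 (darboux_U N \<gamma> s) (darboux_T I \<gamma> s) = darboux_V N I \<gamma> s"
    by (simp add: darboux_V_def)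
  note fr = orthonormal_frame_expand(1-3)[OF on, unfolded Vc]
  show "kg = geodesic_curvature N I \<gamma> s" "kn = normal_curvature N I \<gamma> s"
    "tg = geodesic_torsion N I \<gamma> s"
    unfolding geodesic_curvature_def normal_curvature_def geodesic_torsion_def T V
    using on fr by (simp_all add: inner_add_right inner_diff_right dot_square_norm inner_commute)
qed

end

theory Submission
  imports Defs
begin

text \<open>
  Put \<open>a = T \<bullet> d\<close> and \<open>b = U \<bullet> d\<close>, so that \<open>d = a T + cos \<theta> V + b U\<close> and
  \<open>a\<^sup>2 + b\<^sup>2 = sin\<^sup>2 \<theta>\<close>. As \<open>V \<bullet> d\<close> is constant, the equation for \<open>V'\<close> gives
  \<open>\<kappa>g a = \<tau>g b\<close>: the vector \<open>(a, b)\<close> is a multiple \<open>\<sigma>\<close> of the unit vector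
  \<open>(\<tau>g, \<kappa>g) / sqrt (\<kappa>g\<^sup>2 + \<tau>g\<^sup>2)\<close>, where \<open>\<sigma>\<^sup>2 = sin\<^sup>2 \<theta>\<close>. Since \<open>\<sigma>\<close> is continuous
  and takes at most the two values \<open>sin \<theta>\<close> and \<open>- sin \<theta>\<close> on an interval, it is constant; this is
  the sign \<open>\<epsilon>\<close>, and the first formula follows. Differentiating \<open>\<kappa>g a = \<tau>g b\<close> once more,
  with \<open>a'\<close> and \<open>b'\<close> taken from the equations for \<open>T'\<close> and \<open>U'\<close>, and substituting
  \<open>a\<close> and \<open>b\<close>, gives
  \<open>cos \<theta> (\<kappa>g\<^sup>2 + \<tau>g\<^sup>2) powr (3/2) = \<epsilon> sin \<theta> (\<tau>g' \<kappa>g - \<kappa>g' \<tau>g - \<kappa>n (\<kappa>g\<^sup>2 + \<tau>g\<^sup>2))\<close>.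

  Division by \<open>sin \<theta>\<close> is legitimate because \<open>sin \<theta> = 0\<close> would make \<open>a\<close> and \<open>b\<close> vanish
  identically, and then \<open>b' = 0\<close> forces \<open>\<tau>g = 0\<close>.

  The analytic content is the differentiability of \<open>\<kappa>g\<close> and \<open>\<tau>g\<close> (lemma
  \<open>darboux_curvatures_differentiable\<close>). For \<open>\<tau>g = - U' \<bullet> V\<close> it rests on \<open>U\<close> being twice
  differentiable along the curve, which is the chain rule for a local smooth extension of the
  normal field (lemma \<open>deriv_on_smooth_comp_differentiable\<close>).
\<close>

section \<open>Regularity of the curvatures\<close>

text \<open>
  Near \<open>s\<close> the map agrees with a smooth map \<open>G\<close> on an open set, so its derivative along the
  curve is \<open>D G(\<gamma>) \<gamma>'\<close>. Smoothness of \<open>G\<close> is available only for one fixed direction of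
  differentiation at a time; expanding \<open>\<gamma>'\<close> in the standard basis separates the two
  dependencies on the parameter.
\<close>
lemma deriv_on_smooth_comp_differentiable:
  fixes \<gamma> :: "real \<Rightarrow> 'a::euclidean_space" and F :: "'a \<Rightarrow> 'b::euclidean_space"
  assumes I: "is_interval I" "interior I \<noteq> {}" "s \<in> I"
    and F: "smooth_on_subset F M" and im: "\<gamma> ` I \<subseteq> M"
    and g: "\<gamma> differentiable_on I" and g': "deriv_on I \<gamma> differentiable_on I"
  shows "deriv_on I (\<lambda>t. F (\<gamma> t)) differentiable (at s within I)"
proof -
  have gs: "\<gamma> s \<in> M" using im I(3) by blast
  obtain W G where W: "\<gamma> s \<in> W" "smooth_on_open G W" "\<And>x. x \<in> M \<inter> W \<Longrightarrow> G x = F x"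
    using F gs unfolding smooth_on_subset_def by metis
  have C2: "C_k_on (Suc (Suc 0)) G W" and W_open: "open W"
    using W(2) unfolding smooth_on_open_def by blast+
  have G: "G differentiable (at x)" if "x \<in> W" for x
    using C2 that by simp
  have G': "(\<lambda>x. frechet_derivative G (at x) v) differentiable (at x)" if "x \<in> W" for x v
    using C2 that by simp
  have dg: "\<gamma> differentiable (at t within I)" if "t \<in> I" for t
    using g that unfolding differentiable_on_def by blast
  have dg': "deriv_on I \<gamma> differentiable (at t within I)" if "t \<in> I" for t
    using g' that unfolding differentiable_on_def by blast
  have "continuous (at s within I) \<gamma>"
    using dg[OF I(3)] differentiable_imp_continuous_within by blast
  hence "\<forall>\<^sub>F t in at s within I. \<gamma> t \<in> W"
    using W(1) W_open by (simp add: continuous_within topological_tendstoD)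
  then obtain \<delta> where \<delta>: "\<delta> > 0" "\<And>t. t \<in> I \<Longrightarrow> dist t s < \<delta> \<Longrightarrow> \<gamma> t \<in> W"
    using W(1) unfolding eventually_at by metis
  define H where
    "H = (\<lambda>t. \<Sum>b\<in>Basis. (deriv_on I \<gamma> t \<bullet> b) *\<^sub>R frechet_derivative G (at (\<gamma> t)) b)"
  have H_eq: "deriv_on I (\<lambda>t. F (\<gamma> t)) t = H t" if t: "t \<in> I" "dist t s < \<delta>" for t
  proof -
    have tW: "\<gamma> t \<in> W" using \<delta>(2) t by blast
    let ?D = "frechet_derivative G (at (\<gamma> t))"
    have D: "(G has_derivative ?D) (at (\<gamma> t))"
      using G[OF tW] frechet_derivative_works by blast
    have "((G \<circ> \<gamma>) has_vector_derivative ?D (deriv_on I \<gamma> t)) (at t within I)"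
      by (rule vector_derivative_diff_chain_within[OF deriv_on_works[OF dg[OF t(1)]]])
         (rule has_derivative_at_withinI[OF D])
    moreover have "\<delta> - dist t s > 0" using t(2) by simp
    moreover have "(G \<circ> \<gamma>) u = F (\<gamma> u)" if u: "u \<in> I" "dist u t < \<delta> - dist t s" for u
    proof -
      have "dist u s < \<delta>" using u(2) dist_triangle[of u s t] by linarith
      thus ?thesis using W(3) \<delta>(2) u(1) im by auto
    qed
    ultimately have
      "((\<lambda>t. F (\<gamma> t)) has_vector_derivative ?D (deriv_on I \<gamma> t)) (at t within I)"
      using t(1) unfolding has_vector_derivative_def
      by (metis (no_types, lifting) has_derivative_transform_within)
    hence "deriv_on I (\<lambda>t. F (\<gamma> t)) t = ?D (deriv_on I \<gamma> t)"
      using deriv_on_eq[OF I(1,2) t(1)] by blast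
    also have "\<dots> = ?D (\<Sum>b\<in>Basis. (deriv_on I \<gamma> t \<bullet> b) *\<^sub>R b)"
      by (simp only: euclidean_representation)
    also have "\<dots> = H t"
      unfolding H_def using has_derivative_linear[OF D]
      by (simp add: linear_sum linear_cmul)
    finally show ?thesis .
  qed
  have "H differentiable (at s within I)"
    unfolding H_def
  proof (rule differentiable_sum[OF finite_Basis], rule ballI)
    fix b :: 'a
    have "(\<lambda>t. frechet_derivative G (at (\<gamma> t)) b) differentiable (at s within I)"
      using differentiable_chain_within[OF dg[OF I(3)] differentiable_at_withinI[OF G'[OF W(1)]]]
      by (simp add: o_def)
    moreover have "(\<lambda>t. deriv_on I \<gamma> t \<bullet> b) differentiable (at s within I)"
      using dg'[OF I(3)] by (intro differentiable_inner) simp_all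
    ultimately show "(\<lambda>t. (deriv_on I \<gamma> t \<bullet> b) *\<^sub>R frechet_derivative G (at (\<gamma> t)) b)
        differentiable (at s within I)"
      by (intro differentiable_scaleR)
  qed
  thus ?thesis
    by (rule differentiable_transform_within[OF _ \<delta>(1) I(3)]) (rule H_eq[symmetric])
qed

lemma darboux_curvatures_differentiable:
  assumes M: "oriented_surface M N" and \<gamma>: "unit_speed_curve_on_surface M I \<gamma>" and s: "s \<in> I"
  shows "geodesic_curvature N I \<gamma> differentiable (at s within I)"
    and "geodesic_torsion N I \<gamma> differentiable (at s within I)"
proof -
  have I: "is_interval I" "interior I \<noteq> {}" and im: "\<gamma> ` I \<subseteq> M"
    using \<gamma> by (auto simp: unit_speed_curve_on_surface_def)
  have D: "((deriv_on I ^^ k) \<gamma>) differentiable_on I" for k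
    using \<gamma> by (auto simp: unit_speed_curve_on_surface_def smooth_curve_on_def)
  note dV = darboux_differentiable(3)[OF M \<gamma>]
  have "deriv_on I (darboux_T I \<gamma>) differentiable (at s within I)"
    using D[of 2] s by (simp add: darboux_T_def differentiable_on_def numeral_2_eq_2)
  thus "geodesic_curvature N I \<gamma> differentiable (at s within I)"
    unfolding geodesic_curvature_def using dV[OF s] by (rule differentiable_inner)
  have "smooth_on_subset N M" using M by (simp add: oriented_surface_def)
  hence "deriv_on I (darboux_U N \<gamma>) differentiable (at s within I)"
    unfolding darboux_U_def
    using deriv_on_smooth_comp_differentiable[OF I s _ im] D[of 0] D[of 1] by simp
  hence dUV: "(\<lambda>t. - (deriv_on I (darboux_U N \<gamma>) t \<bullet> darboux_V N I \<gamma> t))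
      differentiable (at s within I)"
    using dV[OF s] by (intro differentiable_minus differentiable_inner)
  \<comment> \<open>Rewriting \<open>V' \<bullet> U\<close> as \<open>- U' \<bullet> V\<close> avoids differentiating \<open>V = U \<times> T\<close> twice.\<close>
  have "- (deriv_on I (darboux_U N \<gamma>) t \<bullet> darboux_V N I \<gamma> t) = geodesic_torsion N I \<gamma> t"
    if t: "t \<in> I" for t
    unfolding geodesic_torsion_def
    using deriv_on_inner_const[OF I t dV[OF t] darboux_differentiable(2)[OF M \<gamma> t], of 0]
    by (simp add: darboux_V_def dot_cross_self)
  thus "geodesic_torsion N I \<gamma> differentiable (at s within I)"
    using differentiable_transform_within[OF dUV zero_less_one s] by blast
qed

section \<open>Constancy of the sign\<close>

lemma continuous_square_const_sign:
  fixes f :: "'a::topological_space \<Rightarrow> real"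
  assumes "connected S" "continuous_on S f" "\<And>x. x \<in> S \<Longrightarrow> (f x)\<^sup>2 = r\<^sup>2"
  obtains \<epsilon> where "\<epsilon> \<in> {1, -1}" "\<And>x. x \<in> S \<Longrightarrow> f x = \<epsilon> * r"
proof -
  have val: "f x = r \<or> f x = - r" if "x \<in> S" for x
    using assms(3)[OF that] by (simp add: power2_eq_iff)
  hence "f ` S \<subseteq> {r, -r}" by blast
  hence "finite (f ` S)" by (rule finite_subset) simp
  hence "f constant_on S"
    using continuous_finite_range_constant assms(1,2) by blast
  then obtain c where c: "\<And>x. x \<in> S \<Longrightarrow> f x = c"
    unfolding constant_on_def by blast
  show ?thesis
  proof (cases "c = r")
    case True
    thus ?thesis using c that[of 1] by simp
  next
    case False
    have "f x = - r" if "x \<in> S" for x using c val False that by metis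
    thus ?thesis using that[of "-1"] by simp
  qed
qed

section \<open>The axis of a relatively normal-slant helix\<close>

theorem mainTheorem2:
  fixes M :: "(real^3) set" and N :: "real^3 \<Rightarrow> real^3"
    and I :: "real set" and \<gamma> :: "real \<Rightarrow> real^3" and d :: "real^3" and \<theta> :: real
  defines "T \<equiv> darboux_T I \<gamma>" and "V \<equiv> darboux_V N I \<gamma>" and "U \<equiv> darboux_U N \<gamma>"
    and "\<kappa>g \<equiv> geodesic_curvature N I \<gamma>" and "\<kappa>n \<equiv> normal_curvature N I \<gamma>"
    and "\<tau>g \<equiv> geodesic_torsion N I \<gamma>"
  assumes "oriented_surface M N"
    and "unit_speed_curve_on_surface M I \<gamma>"
    and "\<forall>s\<in>I. \<tau>g s \<noteq> 0"
    and "\<theta> \<in> {0..pi}"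
    and "relatively_normal_slant_helix N I \<gamma> d \<theta>"
  shows "\<exists>\<epsilon>\<in>{1, -1}. \<forall>s\<in>I.
      d = (\<epsilon> * (\<tau>g s / sqrt ((\<kappa>g s)\<^sup>2 + (\<tau>g s)\<^sup>2)) * sin \<theta>) *\<^sub>R T s
          + cos \<theta> *\<^sub>R V s
          + (\<epsilon> * (\<kappa>g s / sqrt ((\<kappa>g s)\<^sup>2 + (\<tau>g s)\<^sup>2)) * sin \<theta>) *\<^sub>R U s
      \<and> cot \<theta> = \<epsilon> * ((deriv_on I \<tau>g s * \<kappa>g s - deriv_on I \<kappa>g s * \<tau>g s
                        - \<kappa>n s * ((\<kappa>g s)\<^sup>2 + (\<tau>g s)\<^sup>2))
                      / ((\<kappa>g s)\<^sup>2 + (\<tau>g s)\<^sup>2) powr (3/2))"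
proof -
  note M = assms(7) and \<gamma> = assms(8)
  have tau0: "\<tau>g s \<noteq> 0" if "s \<in> I" for s using assms(9) that by blast
  have d1: "norm d = 1" and Vd: "\<And>s. s \<in> I \<Longrightarrow> V s \<bullet> d = cos \<theta>"
    using assms(11) by (auto simp: relatively_normal_slant_helix_def V_def)
  have I: "is_interval I" "interior I \<noteq> {}"
    using \<gamma> by (auto simp: unit_speed_curve_on_surface_def)
  note defs = T_def[symmetric] U_def[symmetric] V_def[symmetric]
    \<kappa>g_def[symmetric] \<kappa>n_def[symmetric] \<tau>g_def[symmetric]
  note on = darboux_orthonormal[OF M \<gamma>, unfolded defs]
  have Vc: "V t = cross3 (U t) (T t)" for t by (simp add: T_def U_def V_def darboux_V_def)
  note fr = orthonormal_frame_expand[OF on, folded Vc]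
  note eqs = darboux_equations[OF M \<gamma>, unfolded defs]
  note dk = darboux_curvatures_differentiable(1)[OF M \<gamma>, unfolded defs]
  note dt = darboux_curvatures_differentiable(2)[OF M \<gamma>, unfolded defs]

  define a where "a t = T t \<bullet> d" for t
  define b where "b t = U t \<bullet> d" for t
  have inner_d: "((\<lambda>t. X t \<bullet> d) has_vector_derivative X' \<bullet> d) (at s within I)"
    if "(X has_vector_derivative X') (at s within I)" for X X' s
    using bounded_linear.has_vector_derivative[OF bounded_linear_inner_left that] .
  have a': "(a has_vector_derivative \<kappa>g s * cos \<theta> + \<kappa>n s * b s) (at s within I)"
    if s: "s \<in> I" for s
    using inner_d[OF eqs(1)[OF s]] Vd[OF s] by (simp add: a_def[abs_def] b_def inner_add_left)
  have b': "(b has_vector_derivative - \<kappa>n s * a s - \<tau>g s * cos \<theta>) (at s within I)"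
    if s: "s \<in> I" for s
    using inner_d[OF eqs(3)[OF s]] Vd[OF s] by (simp add: a_def b_def[abs_def] inner_diff_left)
  have rel: "\<kappa>g s * a s = \<tau>g s * b s" if s: "s \<in> I" for s
  proof -
    have "((\<lambda>t. V t \<bullet> d) has_vector_derivative - \<kappa>g s * a s + \<tau>g s * b s) (at s within I)"
      using inner_d[OF eqs(2)[OF s]] by (simp add: a_def b_def inner_diff_left)
    moreover have "((\<lambda>t. V t \<bullet> d) has_vector_derivative 0) (at s within I)"
      by (rule has_vector_derivative_transform[OF s Vd has_vector_derivative_const])
    ultimately have "- \<kappa>g s * a s + \<tau>g s * b s = 0"
      using deriv_on_eq[OF I s] by metis
    thus ?thesis by simp
  qed
  have expand: "d = a s *\<^sub>R T s + cos \<theta> *\<^sub>R V s + b s *\<^sub>R U s" if s: "s \<in> I" for s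
    using fr(4)[OF s s s, of d] Vd[OF s] by (simp add: a_def b_def inner_commute)
  have ab: "(a s)\<^sup>2 + (b s)\<^sup>2 = (sin \<theta>)\<^sup>2" if s: "s \<in> I" for s
  proof -
    have "d \<bullet> d = (a s)\<^sup>2 + (cos \<theta>)\<^sup>2 + (b s)\<^sup>2"
      by (subst (2) expand[OF s])
         (simp add: inner_add_right a_def b_def Vd[OF s] inner_commute[of d] power2_eq_square)
    moreover have "d \<bullet> d = 1" using d1 by (simp add: dot_square_norm)
    ultimately show ?thesis using sin_cos_squared_add[of \<theta>] by linarith
  qed

  have sin0: "sin \<theta> \<noteq> 0"
  proof
    assume sin: "sin \<theta> = 0"
    hence z: "a t = 0" "b t = 0" if "t \<in> I" for t
      using ab[OF that] by (simp_all add: sum_power2_eq_zero_iff)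
    obtain s where s: "s \<in> I" using I(2) interior_subset by blast
    have "(b has_vector_derivative 0) (at s within I)"
      by (rule has_vector_derivative_transform[OF s z(2) has_vector_derivative_const])
    hence "- \<kappa>n s * a s - \<tau>g s * cos \<theta> = 0"
      using b'[OF s] deriv_on_eq[OF I s] by metis
    hence "\<tau>g s * cos \<theta> = 0" using z(1)[OF s] by simp
    moreover have "cos \<theta> \<noteq> 0" using sin sin_cos_squared_add[of \<theta>] by auto
    ultimately show False using tau0[OF s] by simp
  qed

  define r where "r t = sqrt ((\<kappa>g t)\<^sup>2 + (\<tau>g t)\<^sup>2)" for t
  have r_pos: "r t > 0" if "t \<in> I" for t
    using tau0[OF that] by (simp add: r_def sum_power2_gt_zero_iff)
  have r2: "(r t)\<^sup>2 = (\<kappa>g t)\<^sup>2 + (\<tau>g t)\<^sup>2" for t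
    by (simp add: r_def)
  define \<sigma> where "\<sigma> t = (\<tau>g t * a t + \<kappa>g t * b t) / r t" for t
  have sigma_sq: "(\<sigma> s)\<^sup>2 = (sin \<theta>)\<^sup>2" if s: "s \<in> I" for s
  proof -
    have "(\<tau>g s * a s + \<kappa>g s * b s)\<^sup>2 + (\<kappa>g s * a s - \<tau>g s * b s)\<^sup>2
        = ((\<kappa>g s)\<^sup>2 + (\<tau>g s)\<^sup>2) * ((a s)\<^sup>2 + (b s)\<^sup>2)"
      by algebra
    hence "(\<tau>g s * a s + \<kappa>g s * b s)\<^sup>2 = (r s)\<^sup>2 * (sin \<theta>)\<^sup>2"
      using rel[OF s] ab[OF s] r2[of s] by simp
    thus ?thesis using r_pos[OF s] by (simp add: \<sigma>_def power_divide)
  qed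
  have "continuous_on I \<kappa>g" "continuous_on I \<tau>g"
    using dk dt by (auto intro!: differentiable_imp_continuous_on simp: differentiable_on_def)
  moreover have "continuous_on I a" "continuous_on I b"
    by (rule continuous_on_vector_derivative, erule a' b')+
  ultimately have "continuous_on I \<sigma>"
    unfolding \<sigma>_def r_def
    by (intro continuous_intros) (use tau0 in \<open>auto simp: sum_power2_eq_zero_iff\<close>)
  then obtain \<epsilon> where eps: "\<epsilon> \<in> {1, -1}" "\<And>s. s \<in> I \<Longrightarrow> \<sigma> s = \<epsilon> * sin \<theta>"
    using continuous_square_const_sign[of I \<sigma> "sin \<theta>"] sigma_sq is_interval_connected[OF I(1)]
    by metis

  have a_eq: "a s = \<epsilon> * (\<tau>g s / r s) * sin \<theta>" and b_eq: "b s = \<epsilon> * (\<kappa>g s / r s) * sin \<theta>"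
    if s: "s \<in> I" for s
  proof -
    have "\<tau>g s * (\<tau>g s * a s + \<kappa>g s * b s) = (r s)\<^sup>2 * a s"
      unfolding r2 using rel[OF s] by algebra
    moreover have "\<kappa>g s * (\<tau>g s * a s + \<kappa>g s * b s) = (r s)\<^sup>2 * b s"
      unfolding r2 using rel[OF s] by algebra
    ultimately have "a s = \<sigma> s * (\<tau>g s / r s)" "b s = \<sigma> s * (\<kappa>g s / r s)"
      unfolding \<sigma>_def using r_pos[OF s] by (simp_all add: field_simps power2_eq_square)
    thus "a s = \<epsilon> * (\<tau>g s / r s) * sin \<theta>" "b s = \<epsilon> * (\<kappa>g s / r s) * sin \<theta>"
      using eps(2)[OF s] by simp_all
  qed

  have cot_eq: "cot \<theta> = \<epsilon> * ((deriv_on I \<tau>g s * \<kappa>g s - deriv_on I \<kappa>g s * \<tau>g s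
      - \<kappa>n s * ((\<kappa>g s)\<^sup>2 + (\<tau>g s)\<^sup>2)) / ((\<kappa>g s)\<^sup>2 + (\<tau>g s)\<^sup>2) powr (3/2))"
    if s: "s \<in> I" for s
  proof -
    let ?k' = "deriv_on I \<kappa>g s" and ?t' = "deriv_on I \<tau>g s"
    let ?P = "?t' * \<kappa>g s - ?k' * \<tau>g s - \<kappa>n s * (r s)\<^sup>2"
    have L: "((\<lambda>t. \<kappa>g t * a t) has_vector_derivative
        \<kappa>g s * (\<kappa>g s * cos \<theta> + \<kappa>n s * b s) + ?k' * a s) (at s within I)"
      by (rule has_vector_derivative_mult[OF deriv_on_works[OF dk[OF s]] a'[OF s]])
    have "((\<lambda>t. \<tau>g t * b t) has_vector_derivative
        \<tau>g s * (- \<kappa>n s * a s - \<tau>g s * cos \<theta>) + ?t' * b s) (at s within I)"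
      by (rule has_vector_derivative_mult[OF deriv_on_works[OF dt[OF s]] b'[OF s]])
    from has_vector_derivative_transform[OF s rel this]
    have "\<kappa>g s * (\<kappa>g s * cos \<theta> + \<kappa>n s * b s) + ?k' * a s
        = \<tau>g s * (- \<kappa>n s * a s - \<tau>g s * cos \<theta>) + ?t' * b s"
      using L deriv_on_eq[OF I s] by metis
    hence "(r s)\<^sup>2 * cos \<theta> = ?t' * b s - ?k' * a s - \<kappa>n s * (\<tau>g s * a s + \<kappa>g s * b s)"
      unfolding r2 by algebra
    also have "\<tau>g s * a s + \<kappa>g s * b s = r s * (\<epsilon> * sin \<theta>)"
      using eps(2)[OF s] r_pos[OF s] by (simp add: \<sigma>_def field_simps)
    finally have "(r s)^3 * cos \<theta> = \<epsilon> * sin \<theta> * ?P"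
      unfolding a_eq[OF s] b_eq[OF s] using r_pos[OF s]
      by (simp add: field_simps power2_eq_square power3_eq_cube)
    hence "cot \<theta> = \<epsilon> * (?P / (r s)^3)"
      using r_pos[OF s] sin0 by (simp add: cot_def field_simps)
    moreover have "((\<kappa>g s)\<^sup>2 + (\<tau>g s)\<^sup>2) powr (3/2) = (r s)^3"
    proof -
      have "((\<kappa>g s)\<^sup>2 + (\<tau>g s)\<^sup>2) powr (3/2) = (((\<kappa>g s)\<^sup>2 + (\<tau>g s)\<^sup>2) powr (1/2)) powr 3"
        by (simp add: powr_powr)
      also have "\<dots> = r s powr 3"
        by (simp add: r_def powr_half_sqrt)
      also have "\<dots> = (r s)^3"
        using r_pos[OF s] powr_realpow[of "r s" 3] by simp
      finally show ?thesis .
    qed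
    ultimately show ?thesis by (simp add: r2)
  qed

  show ?thesis
  proof (rule bexI[OF _ eps(1)], intro ballI conjI)
    fix s assume s: "s \<in> I"
    show "d = (\<epsilon> * (\<tau>g s / sqrt ((\<kappa>g s)\<^sup>2 + (\<tau>g s)\<^sup>2)) * sin \<theta>) *\<^sub>R T s
          + cos \<theta> *\<^sub>R V s
          + (\<epsilon> * (\<kappa>g s / sqrt ((\<kappa>g s)\<^sup>2 + (\<tau>g s)\<^sup>2)) * sin \<theta>) *\<^sub>R U s"
      using expand[OF s] unfolding a_eq[OF s] b_eq[OF s] r_def .
  qed (rule cot_eq)
qed

end
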